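(* Let $n\ge 1$, let $(a_k)_{k\ge1}$ and $(w_k)_{k\ge 1}$ be complex numbers with $a_1=1$ and $w_1=1$, and let $A_n=W_n+D_n$, where $D_n$ is the $n\times n$ matrix whose $(i,j)$ entry is $a_{j/i}$ if $i\mid j$ and $0$ otherwise, and $W_n$ is the $n\times n$ matrix whose first column is $(0,w_2,\dots,w_n)^T$ and whose other entries are zero. Let $v(n,k)$ be the weighted sums defined in the context and let $r=\lfloor\log_2 n\rfloor$. Then the characteristic polynomial $p_n(x)=\det(xI_n-A_n)$ is $$p_n(x)=(x-1)^{n-r-1}\Big((x-1)^{r+1}-\sum_{k=1}^{r}v(n,k)(x-1)^{r-k}\Big).$$ Consequently, if $v(n,r)\neq0$, the algebraic multiplicity of the trivial eigenvalue $\lambda=1$ of $A_n$ is $n-r-1$.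
   Context: Let $L(s)=\sum_{k=1}^{\infty}a_k k^{-s}$ be the formal Dirichlet series with coefficients $a_k$, $a_1=1$. For integers $m\ge1$ and $k\ge0$, $d(m,k)$ denotes the coefficient of $m^{-s}$ in the formal Dirichlet series $(L(s)-1)^k=\big(\sum_{m\ge2}a_m m^{-s}\big)^k=\sum_{m\ge1}d(m,k)m^{-s}$ (product = Dirichlet convolution; the $0$th power is the series $1$, so $d(1,0)=1$ and $d(m,0)=0$ for $m>1$). Define $v(n,k)=\sum_{1\le j\le n}w_j\,d(j,k)$. The eigenvalue $1$ is called the trivial eigenvalue.
   Formalization: The multiplicity claim is stated for n ≥ 2 only: for n = 1 one has r = 0, v(1,0) = 1 ≠ 0 and A_1 = [1], so the eigenvalue 1 has multiplicity 1, not n − r − 1 = 0. *)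

theory Defs
  imports Complex_Main "Jordan_Normal_Form.Char_Poly"
begin

(* A formal Dirichlet series (sum over m >= 1 of f m * m^(-s)) is represented by its
   coefficient function f :: nat => complex; the value f 0 carries no meaning. *)

definition dirichlet_conv :: "(nat \<Rightarrow> complex) \<Rightarrow> (nat \<Rightarrow> complex) \<Rightarrow> nat \<Rightarrow> complex" where
  "dirichlet_conv f g m = (\<Sum>c | c dvd m. f c * g (m div c))"

definition dirichlet_one :: "nat \<Rightarrow> complex" where
  "dirichlet_one m = (if m = 1 then 1 else 0)"

primrec dirichlet_power :: "(nat \<Rightarrow> complex) \<Rightarrow> nat \<Rightarrow> nat \<Rightarrow> complex" where
  "dirichlet_power f 0 = dirichlet_one"
| "dirichlet_power f (Suc k) = dirichlet_conv f (dirichlet_power f k)"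

(* The coefficient of m^(-s) in (L(s) - 1)^k, where L has coefficients a. *)
definition dcoeff :: "(nat \<Rightarrow> complex) \<Rightarrow> nat \<Rightarrow> nat \<Rightarrow> complex" where
  "dcoeff a m k = dirichlet_power (\<lambda>j. a j - dirichlet_one j) k m"

definition vsum :: "(nat \<Rightarrow> complex) \<Rightarrow> (nat \<Rightarrow> complex) \<Rightarrow> nat \<Rightarrow> nat \<Rightarrow> complex" where
  "vsum a w n k = (\<Sum>j = 1..n. w j * dcoeff a j k)"

(* Matrix indices are 0-based in the library, so position (i, j) below holds the
   entry with 1-based index (i + 1, j + 1). *)

definition D_mat :: "(nat \<Rightarrow> complex) \<Rightarrow> nat \<Rightarrow> complex mat" where
  "D_mat a n = mat n n (\<lambda>(i, j). if Suc i dvd Suc j then a (Suc j div Suc i) else 0)"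

definition W_mat :: "(nat \<Rightarrow> complex) \<Rightarrow> nat \<Rightarrow> complex mat" where
  "W_mat w n = mat n n (\<lambda>(i, j). if j = 0 \<and> i \<noteq> 0 then w (Suc i) else 0)"

definition A_mat :: "(nat \<Rightarrow> complex) \<Rightarrow> (nat \<Rightarrow> complex) \<Rightarrow> nat \<Rightarrow> complex mat" where
  "A_mat a w n = W_mat w n + D_mat a n"

end

theory Submission
  imports Defs
begin

text \<open>
  Put $y = x - 1$ and let $N = D_n - I$. Since the first row of $N^k$ is $(d(1,k), \dots, d(n,k))$ and
  it vanishes for $k = r + 1$, the row vector $u$ with entries $u_j = \sum_{k \le r} d(j,k) y^{r-k}$
  satisfies $u (yI - N) = y^{r+1} e_1$, hence $u (xI - A_n) = q e_1$ with
  $q = y^{r+1} - \sum_{k=1}^r v(n,k) y^{r-k}$. Replacing the first row of $xI - A_n$ by $q e_1$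
  multiplies the determinant by $u_1 = y^r$ and leaves a matrix of determinant $q y^{n-1}$.
\<close>

lemma dirichlet_conv_commute:
  assumes "m > 0"
  shows "dirichlet_conv f g m = dirichlet_conv g f m"
  unfolding dirichlet_conv_def
  by (rule sum.reindex_bij_witness[where i = "\<lambda>c. m div c" and j = "\<lambda>c. m div c"])
     (use assms in \<open>auto simp: mult.commute elim!: dvdE\<close>)

text \<open>A product of \<open>k\<close> integers that are all at least 2 is at least
  \<open>2 ^ k\<close>, so no factorization of \<open>m\<close> contributes. The induction peels off
  one factor \<open>c\<close>: the case \<open>c = 1\<close> is killed by \<open>f 1 = 0\<close>,
  and \<open>c \<ge> 2\<close> at least halves the cofactor.\<close>

lemma dirichlet_power_eq_0:
  assumes "f 1 = 0" "m > 0" "m < 2 ^ k"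
  shows "dirichlet_power f k m = 0"
  using assms(2,3)
proof (induction k arbitrary: m)
  case (Suc k)
  have "f c * dirichlet_power f k (m div c) = 0" if "c dvd m" for c
  proof (cases "c = 1")
    case False
    from that obtain b where b: "m = c * b" by blast
    with Suc.prems False have "c \<ge> 2" "b > 0" by (cases c; auto)+
    then have "2 * b \<le> m" by (simp add: b)
    with Suc.prems have "b < 2 ^ k" by simp
    with Suc.IH[of b] \<open>b > 0\<close> \<open>c \<ge> 2\<close> b show ?thesis by simp
  qed (use assms(1) in simp)
  then show ?case unfolding dirichlet_power.simps dirichlet_conv_def by (intro sum.neutral) blast
qed simp

lemma dcoeff_0: "dcoeff a m 0 = dirichlet_one m"
  by (simp add: dcoeff_def)

lemma dcoeff_eq_0: "a 1 = 1 \<Longrightarrow> m > 0 \<Longrightarrow> m < 2 ^ k \<Longrightarrow> dcoeff a m k = 0"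
  unfolding dcoeff_def by (rule dirichlet_power_eq_0) (simp_all add: dirichlet_one_def)

lemma dcoeff_1_eq_0:
  assumes "a 1 = 1" "k > 0"
  shows "dcoeff a 1 k = 0"
  using one_less_power[of "2 :: nat" k] assms by (intro dcoeff_eq_0) auto

text \<open>\<open>dirichlet_power\<close> puts the new factor on the left. Commuting it to the
  cofactor \<open>m div c\<close> makes the sum the entry at \<open>m\<close> of a row vector times
  $N$, whose entry at \<open>(c, m)\<close> with \<open>c dvd m\<close> is the bracketed
  term.\<close>

lemma dcoeff_Suc:
  assumes "m > 0"
  shows "dcoeff a m (Suc k) =
    (\<Sum>c | c dvd m. dcoeff a c k * (a (m div c) - dirichlet_one (m div c)))"
  using dirichlet_conv_commute[OF assms] by (simp add: dcoeff_def dirichlet_conv_def)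

text \<open>This is the vector $u$ above, with 1-based index \<open>j\<close>: the first row of the
  Neumann series of $(yI - N)^{-1}$, cut off after \<open>k = r\<close> and multiplied by $y^{r+1}$
  to clear denominators.\<close>

definition krylov_row :: "(nat \<Rightarrow> complex) \<Rightarrow> nat \<Rightarrow> nat \<Rightarrow> complex poly" where
  "krylov_row a r j = (\<Sum>k\<le>r. Polynomial.smult (dcoeff a j k) ([:-1, 1:] ^ (r - k)))"

lemma krylov_row_1:
  assumes "a 1 = 1"
  shows "krylov_row a r 1 = [:-1, 1:] ^ r"
proof -
  have "krylov_row a r 1 = (\<Sum>k\<le>r. if k = 0 then [:-1, 1:] ^ r else 0)"
    unfolding krylov_row_def
    using dcoeff_1_eq_0[of a] assms
    by (intro sum.cong) (auto simp: dcoeff_0 dirichlet_one_def)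
  then show ?thesis by simp
qed

text \<open>Column \<open>j\<close> of $u (yI - N) = y^{r+1} e_1$, by telescoping: multiplying by
  $y$ raises the exponent, applying $N$ raises \<open>k\<close>, and both give the same terms except
  at the ends. The end \<open>k = 0\<close> is the right-hand side; the end \<open>k = Suc r\<close>
  vanishes because \<open>j < 2 ^ Suc r\<close>.\<close>

lemma krylov_row_recurrence:
  assumes "a 1 = 1" "j > 0" "j < 2 ^ Suc r"
  shows "[:-1, 1:] * krylov_row a r j -
      (\<Sum>c | c dvd j. Polynomial.smult (a (j div c) - dirichlet_one (j div c)) (krylov_row a r c)) =
    (if j = 1 then [:-1, 1:] ^ Suc r else 0)"
proof -
  let ?y = "[:-1, 1:] :: complex poly"
  let ?g = "\<lambda>k. Polynomial.smult (dcoeff a j k) (?y ^ (Suc r - k))"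
  have "?y * krylov_row a r j = (\<Sum>k\<le>r. ?g k)"
    unfolding krylov_row_def sum_distrib_left
    by (intro sum.cong) (auto simp: Suc_diff_le simp del: mult_pCons_left)
  also have "\<dots> = (\<Sum>k\<le>Suc r. ?g k)"
    using dcoeff_eq_0[of a j "Suc r"] assms by simp
  also have "\<dots> = ?g 0 + (\<Sum>k\<le>r. ?g (Suc k))"
    by (rule sum.atMost_Suc_shift)
  also have "(\<Sum>k\<le>r. ?g (Suc k)) =
      (\<Sum>k\<le>r. \<Sum>c | c dvd j. Polynomial.smult (a (j div c) - dirichlet_one (j div c))
        (Polynomial.smult (dcoeff a c k) (?y ^ (r - k))))"
    by (simp add: dcoeff_Suc[OF assms(2)] smult_sum mult.commute)
  also have "\<dots> = (\<Sum>c | c dvd j. Polynomial.smult (a (j div c) - dirichlet_one (j div c)) (krylov_row a r c))"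
    unfolding krylov_row_def smult_sum2 by (rule sum.swap)
  finally show ?thesis
    by (simp add: dcoeff_0 dirichlet_one_def del: mult_pCons_left)
qed

text \<open>Exchange the two sums. The left side starts at 2 because $W_n$ has a zero in its corner.
  Hence \<open>k = 0\<close> drops out, as $d(j,0) = 0$ for $j \<ge> 2$; for $k \<ge> 1$ the term $j
  = 1$ of \<open>vsum\<close> is zero, as $d(1,k) = 0$.\<close>

lemma krylov_row_weighted_sum:
  assumes "a 1 = 1" "n \<ge> 1"
  shows "(\<Sum>j = 2..n. Polynomial.smult (w j) (krylov_row a r j)) =
    (\<Sum>k = 1..r. Polynomial.smult (vsum a w n k) ([:-1, 1:] ^ (r - k)))"
proof -
  let ?y = "[:-1, 1:] :: complex poly"
  have "(\<Sum>j = 2..n. Polynomial.smult (w j) (krylov_row a r j)) =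
      (\<Sum>k\<le>r. \<Sum>j = 2..n. Polynomial.smult (w j * dcoeff a j k) (?y ^ (r - k)))"
    unfolding krylov_row_def smult_sum2 by (subst sum.swap) simp
  also have "\<dots> = (\<Sum>k\<le>r. Polynomial.smult (\<Sum>j = 2..n. w j * dcoeff a j k) (?y ^ (r - k)))"
    by (simp add: smult_sum)
  also have "\<dots> = (\<Sum>k = 1..r. Polynomial.smult (\<Sum>j = 2..n. w j * dcoeff a j k) (?y ^ (r - k)))"
  proof (rule sum.mono_neutral_right)
    show "\<forall>k\<in>{..r} - {1..r}. Polynomial.smult (\<Sum>j = 2..n. w j * dcoeff a j k) (?y ^ (r - k)) = 0"
      by (auto simp: dcoeff_0 dirichlet_one_def Suc_le_eq intro!: sum.neutral)
  qed auto
  also have "\<dots> = (\<Sum>k = 1..r. Polynomial.smult (vsum a w n k) (?y ^ (r - k)))"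
  proof (rule sum.cong)
    fix k assume "k \<in> {1..r}"
    then have "dcoeff a 1 k = 0" by (intro dcoeff_1_eq_0) (use assms in auto)
    moreover have "vsum a w n k = w 1 * dcoeff a 1 k + (\<Sum>j = 2..n. w j * dcoeff a j k)"
      unfolding vsum_def using assms(2)
      by (simp add: sum.atLeast_Suc_atMost numeral_2_eq_2)
    ultimately show "Polynomial.smult (\<Sum>j = 2..n. w j * dcoeff a j k) (?y ^ (r - k)) =
        Polynomial.smult (vsum a w n k) (?y ^ (r - k))" by simp
  qed simp
  finally show ?thesis .
qed

lemma A_mat_carrier [simp]: "A_mat a w n \<in> carrier_mat n n"
  by (simp add: A_mat_def W_mat_def D_mat_def)

text \<open>Moving the unit diagonal of $D_n$ into the first term exhibits $xI - A_n$ as $yI - N -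
  W_n$, the shape to which the recurrence for $u$ applies.\<close>

lemma char_poly_matrix_A_mat:
  assumes "a 1 = 1" "i < n" "j < n"
  shows "char_poly_matrix (A_mat a w n) $$ (i, j) =
    (if i = j then [:-1, 1:] else 0) -
    (if Suc i dvd Suc j then [:a (Suc j div Suc i) - dirichlet_one (Suc j div Suc i):] else 0) -
    (if j = 0 \<and> i \<noteq> 0 then [:w (Suc i):] else 0)"
proof -
  \<comment> \<open>Divisibility matters here: the truncated quotient can be 1 off the diagonal, as
    in \<open>3 div 2\<close>.\<close>
  have "Suc j div Suc i = 1 \<longleftrightarrow> i = j" if "Suc i dvd Suc j"
    using that
    by (metis One_nat_def Suc_inject div_by_Suc_0 dvd_div_mult_self mult.left_neutral div_self nat.distinct(1))
  then show ?thesis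
    using assms by (auto simp: char_poly_matrix_def A_mat_def W_mat_def D_mat_def dirichlet_one_def)
qed

text \<open>Column \<open>j\<close> of $u (xI - A_n) = q e_1$: the part $yI - N$ gives the
  recurrence at \<open>Suc j\<close>, and $W_n$ contributes only to the first column, where it
  subtracts the weighted sum.\<close>

lemma krylov_row_mult_char_poly_matrix:
  assumes "a 1 = 1" "n < 2 ^ Suc r" "j < n"
  shows "(\<Sum>i<n. krylov_row a r (Suc i) * char_poly_matrix (A_mat a w n) $$ (i, j)) =
    (if j = 0 then [:-1, 1:] ^ Suc r - (\<Sum>k = 1..r. Polynomial.smult (vsum a w n k) ([:-1, 1:] ^ (r - k)))
     else 0)"
proof -
  let ?y = "[:-1, 1:] :: complex poly"
  let ?u = "krylov_row a r"
  let ?f = "\<lambda>m. a m - dirichlet_one m"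
  \<comment> \<open>Every divisor of \<open>Suc j\<close> is at most \<open>n\<close>, so the rows
    \<open>i < n\<close> with \<open>c = Suc i\<close> reach all of them.\<close>
  have div: "(\<Sum>i<n. if Suc i dvd Suc j then Polynomial.smult (?f (Suc j div Suc i)) (?u (Suc i)) else 0) =
      (\<Sum>c | c dvd Suc j. Polynomial.smult (?f (Suc j div c)) (?u c))"
  proof -
    have "(\<Sum>i<n. if Suc i dvd Suc j then Polynomial.smult (?f (Suc j div Suc i)) (?u (Suc i)) else 0) =
      (\<Sum>i | i < n \<and> Suc i dvd Suc j. Polynomial.smult (?f (Suc j div Suc i)) (?u (Suc i)))"
      by (intro sum.mono_neutral_cong_right) auto
    also have "\<dots> = (\<Sum>c | c dvd Suc j. Polynomial.smult (?f (Suc j div c)) (?u c))"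
    proof (rule sum.reindex_bij_witness[where i = "\<lambda>c. c - 1" and j = Suc])
      fix c assume "c \<in> {c. c dvd Suc j}"
      then have c: "c dvd Suc j" by simp
      then have "c \<le> Suc j" "c > 0" by (auto dest: dvd_imp_le intro: Nat.gr0I)
      then show "Suc (c - 1) = c" "c - 1 \<in> {i. i < n \<and> Suc i dvd Suc j}"
        using c assms(3) by auto
    qed auto
    finally show ?thesis .
  qed
  have weights: "(\<Sum>i<n. if j = 0 \<and> i \<noteq> 0 then Polynomial.smult (w (Suc i)) (?u (Suc i)) else 0) =
      (if j = 0 then \<Sum>k = 1..r. Polynomial.smult (vsum a w n k) (?y ^ (r - k)) else 0)"
  proof (cases "j = 0")
    case True
    have "(\<Sum>i<n. if i \<noteq> 0 then Polynomial.smult (w (Suc i)) (?u (Suc i)) else 0) =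
        (\<Sum>i\<in>{..<n} - {0}. Polynomial.smult (w (Suc i)) (?u (Suc i)))"
      by (intro sum.mono_neutral_cong_right) auto
    also have "\<dots> = (\<Sum>j = 2..n. Polynomial.smult (w j) (?u j))"
      by (rule sum.reindex_bij_witness[where i = "\<lambda>c. c - 1" and j = Suc]) auto
    finally have "(\<Sum>i<n. if i \<noteq> 0 then Polynomial.smult (w (Suc i)) (?u (Suc i)) else 0) =
        (\<Sum>j = 2..n. Polynomial.smult (w j) (?u j))" .
    then show ?thesis using True krylov_row_weighted_sum[of a n w r] assms by simp
  qed simp
  have "(\<Sum>i<n. ?u (Suc i) * char_poly_matrix (A_mat a w n) $$ (i, j)) =
    (\<Sum>i<n. if i = j then ?y * ?u (Suc i) else 0) -
    (\<Sum>i<n. if Suc i dvd Suc j then Polynomial.smult (?f (Suc j div Suc i)) (?u (Suc i)) else 0) -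
    (\<Sum>i<n. if j = 0 \<and> i \<noteq> 0 then Polynomial.smult (w (Suc i)) (?u (Suc i)) else 0)"
    unfolding sum_subtractf[symmetric]
    using assms(1,3)
    by (intro sum.cong refl)
       (auto simp: char_poly_matrix_A_mat right_diff_distrib simp del: diff_pCons minus_pCons)
  also have "\<dots> = ?y * ?u (Suc j) - (\<Sum>c | c dvd Suc j. Polynomial.smult (?f (Suc j div c)) (?u c)) -
      (if j = 0 then \<Sum>k = 1..r. Polynomial.smult (vsum a w n k) (?y ^ (r - k)) else 0)"
    unfolding div weights using assms(3) by (simp del: mult_pCons_left)
  also have "?y * ?u (Suc j) - (\<Sum>c | c dvd Suc j. Polynomial.smult (?f (Suc j div c)) (?u c)) =
      (if Suc j = 1 then ?y ^ Suc r else 0)"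
    by (rule krylov_row_recurrence) (use assms in auto)
  finally show ?thesis by (auto simp del: mult_pCons_left power_Suc)
qed

text \<open>Both sides are the determinant of the matrix with its first row replaced. The factor
  $y^r$ stays on the left, so that the identity remains one of polynomials.\<close>

lemma power_mult_char_poly_A_mat:
  assumes "a 1 = 1" "n \<ge> 1" "n < 2 ^ Suc r"
  shows "[:-1, 1:] ^ r * char_poly (A_mat a w n) = [:-1, 1:] ^ (n - 1) *
    ([:-1, 1:] ^ Suc r - (\<Sum>k = 1..r. Polynomial.smult (vsum a w n k) ([:-1, 1:] ^ (r - k))))"
proof -
  let ?y = "[:-1, 1:] :: complex poly"
  define q where "q = ?y ^ Suc r - (\<Sum>k = 1..r. Polynomial.smult (vsum a w n k) (?y ^ (r - k)))"
  define M where "M = char_poly_matrix (A_mat a w n)"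
  \<comment> \<open>The identity matrix with first row $u$: multiplying by it from the left replaces
    the first row of \<open>M\<close> by $u$ times \<open>M\<close> and keeps the other
    rows.\<close>
  define P where "P = mat n n (\<lambda>(i, j). if i = 0 then krylov_row a r (Suc j) else of_bool (i = j))"
  have carrier [simp]: "M \<in> carrier_mat n n" "P \<in> carrier_mat n n" "P * M \<in> carrier_mat n n"
    by (auto simp: M_def P_def intro!: mult_carrier_mat[of _ n n])
  then have dims [simp]: "dim_row M = n" "dim_col M = n" "dim_row P = n" "dim_col P = n"
    by blast+
  \<comment> \<open>Outside the first column $W_n$ is absent, and \<open>Suc i dvd Suc j\<close>
    with \<open>j \<le> i\<close> forces \<open>i = j\<close>.\<close>
  have M: "M $$ (i, j) = (if i = j then ?y else 0)" if "j \<le> i" "0 < j" "i < n" for i j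
    using that assms unfolding M_def
    by (subst char_poly_matrix_A_mat) (auto simp: dirichlet_one_def dest: dvd_imp_le)
  have PM: "(P * M) $$ (i, j) = (if i = 0 then if j = 0 then q else 0 else M $$ (i, j))"
    if "i < n" "j < n" for i j
  proof -
    have "(P * M) $$ (i, j) = (\<Sum>l<n. P $$ (i, l) * M $$ (l, j))"
      using that by (simp add: scalar_prod_def atLeast0LessThan)
    also have "\<dots> = (if i = 0 then if j = 0 then q else 0 else M $$ (i, j))"
    proof (cases "i = 0")
      case True
      then show ?thesis
        using that krylov_row_mult_char_poly_matrix[of a n r j w] assms
        by (simp add: P_def M_def q_def del: power_Suc)
    next
      case False
      then have "(\<Sum>l<n. P $$ (i, l) * M $$ (l, j)) = (\<Sum>l<n. if l = i then M $$ (l, j) else 0)"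
        using that by (intro sum.cong) (auto simp: P_def)
      with False that show ?thesis by simp
    qed
    finally show ?thesis .
  qed
  have "det P = prod_list (diag_mat P)"
    by (rule det_upper_triangular) (auto simp: P_def)
  also have "\<dots> = ?y ^ r"
    using assms(2) krylov_row_1[of a r] assms(1)
    by (simp add: prod_list_diag_prod P_def prod.atLeast_Suc_lessThan)
  finally have det_P: "det P = ?y ^ r" .
  \<comment> \<open>The first row of \<open>P * M\<close> is \<open>q\<close> followed by zeros, so
    only this minor survives the expansion. It omits the first column, where the weights sit, and is
    therefore upper triangular with $y$ on the diagonal.\<close>
  let ?B = "mat_delete (P * M) 0 0"
  have B: "?B $$ (i, j) = M $$ (Suc i, Suc j)" if "i < n - 1" "j < n - 1" for i j
    using that by (simp add: mat_delete_def PM del: index_mult_mat(1))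
  have B_carrier: "?B \<in> carrier_mat (n - 1) (n - 1)"
    by (auto simp: mat_delete_def)
  then have B_dims: "dim_row ?B = n - 1" "dim_col ?B = n - 1" by blast+
  have "det ?B = prod_list (diag_mat ?B)"
    by (rule det_upper_triangular[OF _ B_carrier]) (use M B B_dims in \<open>auto simp: upper_triangular_def\<close>)
  also have "\<dots> = ?y ^ (n - 1)"
    using M B B_dims by (simp add: prod_list_diag_prod)
  finally have det_B: "det ?B = ?y ^ (n - 1)" .
  have "det (P * M) = (\<Sum>j<n. (P * M) $$ (0, j) * cofactor (P * M) 0 j)"
    using assms(2) by (intro laplace_expansion_row) auto
  also have "\<dots> = (\<Sum>j<n. if j = 0 then q * cofactor (P * M) 0 0 else 0)"
    using assms(2) by (intro sum.cong) (auto simp: PM simp del: index_mult_mat(1))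
  also have "\<dots> = q * ?y ^ (n - 1)"
    using assms(2) by (simp add: cofactor_def det_B)
  finally have "det P * det M = q * ?y ^ (n - 1)"
    by (simp add: det_mult[of _ n])
  then show ?thesis
    by (simp add: det_P M_def char_poly_def q_def mult.commute)
qed

theorem theorem3p2:
  fixes n r :: nat and a w :: "nat \<Rightarrow> complex"
  assumes "n \<ge> 1" and "a 1 = 1" and "w 1 = 1"
    and "r = nat \<lfloor>log 2 (real n)\<rfloor>"
  shows "char_poly (A_mat a w n) =
           [:-1, 1:] ^ (n - r - 1) *
             ([:-1, 1:] ^ (r + 1) - (\<Sum>k = 1..r. Polynomial.smult (vsum a w n k) ([:-1, 1:] ^ (r - k))))
         \<and> (n \<ge> 2 \<longrightarrow> vsum a w n r \<noteq> 0 \<longrightarrow>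
              Polynomial.order 1 (char_poly (A_mat a w n)) = n - r - 1)"
proof -
  let ?y = "[:-1, 1:] :: complex poly"
  define q where "q = ?y ^ (r + 1) - (\<Sum>k = 1..r. Polynomial.smult (vsum a w n k) (?y ^ (r - k)))"
  have "\<lfloor>log 2 (real n)\<rfloor> = int r"
    using assms(1,4) by simp
  then have r: "2 ^ r \<le> n" "n < 2 ^ Suc r"
    using floor_log_nat_eq_powr_iff[of 2 n r] assms(1) by auto
  \<comment> \<open>This makes the truncated subtraction \<open>n - r - 1\<close> exact, so the
    exponents \<open>r\<close> and \<open>n - r - 1\<close> add up to \<open>n - 1\<close>.\<close>
  have "r < n" using r(1) less_exp[of r] by linarith
  then have "?y ^ (n - 1) = ?y ^ r * ?y ^ (n - r - 1)"
    by (simp flip: power_add)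
  then have "?y ^ r * char_poly (A_mat a w n) = ?y ^ r * (?y ^ (n - r - 1) * q)"
    using power_mult_char_poly_A_mat[of a n r w] assms r(2)
    by (simp add: q_def mult.assoc)
  then have eq: "char_poly (A_mat a w n) = ?y ^ (n - r - 1) * q"
    by simp
  have "Polynomial.order 1 (char_poly (A_mat a w n)) = n - r - 1" if "n \<ge> 2" "vsum a w n r \<noteq> 0"
  proof -
    \<comment> \<open>The sum in \<open>q\<close> must contain the term \<open>k = r\<close>. For
      \<open>n = 1\<close> it is empty, and \<open>q\<close> is $y$, which vanishes at 1.\<close>
    have "r \<ge> 1" using r that(1) by (cases r) auto
    \<comment> \<open>At $x = 1$ every positive power of $y$ vanishes, which leaves only
      \<open>k = r\<close>. So 1 is no root of \<open>q\<close>, and the whole multiplicity comes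
      from the power of $y$ in front.\<close>
    then have "poly q 1 = - vsum a w n r"
      by (simp add: q_def poly_sum power_0_left sum.remove[of _ r])
    with that(2) have "Polynomial.order 1 q = 0" "q \<noteq> 0"
      by (auto simp: order_root intro!: order_0I)
    then show ?thesis
      unfolding eq using order_power_n_n[of 1 "n - r - 1"] by (subst order_mult) auto
  qed
  with eq show ?thesis by (simp add: q_def)
qed

end
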